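(* Let $\zeta,T\in\mathbb N$. Let $\phi$ be the softmax function. Define $$f:\mathbb R^\zeta\times\mathbb R^T\times\bigcup_{t=1}^T[\zeta]^t\to\mathbb R,\qquad (z,u,\alpha)\mapsto\langle x,\phi(x\,x_{|\alpha|})\rangle,\quad\text{where } x=(z_{\alpha_t}+u_t)_{t=1}^{|\alpha|}\in\mathbb R^{|\alpha|}.$$ Then, for generic $(z,u)\in\mathbb R^\zeta\times\mathbb R^T$, the map $f(z,u,\cdot)$ is an injective map from $\bigcup_{t=1}^T[\zeta]^t$ into $\mathbb R\setminus\{0\}$.
   Context: $[\zeta]=\{1,\ldots,\zeta\}$; $|\alpha|$ is the length of the sequence $\alpha$; $x_{|\alpha|}$ is the last entry of $x$, and $x\,x_{|\alpha|}$ is the vector $x$ multiplied by this scalar. The softmax function on $\mathbb R^n$ (for any $n$) is $\phi(x)_i=\exp(x_i)/\sum_{j=1}^n\exp(x_j)$. A property holds for generic points if the set of exceptions is contained in the zero set of a real analytic function (here on $\mathbb R^\zeta\times\mathbb R^T$) that is not identically zero. *)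

theory Defs
  imports Complex_Main "HOL-Library.FuncSet" "HOL-Analysis.Infinite_Sum"
    "Jordan_Normal_Form.Matrix"
begin

text \<open>Vectors in $\mathbb R^n$ are elements of \<^term>\<open>carrier_vec n :: real vec set\<close>; their entries
  are indexed by \<open>0, \<dots>, n - 1\<close>.\<close>

definition softmax :: "real vec \<Rightarrow> real vec" where
  "softmax x = vec (dim_vec x) (\<lambda>i. exp (x $ i) / (\<Sum>j<dim_vec x. exp (x $ j)))"

text \<open>Tokens are \<open>1, \<dots>, \<zeta>\<close>, so the coordinate of \<open>z\<close> belonging to token \<open>a\<close> is \<open>z $ (a - 1)\<close>.\<close>

definition token_seqs :: "nat \<Rightarrow> nat \<Rightarrow> nat list set" where
  "token_seqs \<zeta> T = (\<Union>t\<in>{1..T}. {\<alpha>. length \<alpha> = t \<and> set \<alpha> \<subseteq> {1..\<zeta>}})"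

definition embed_seq :: "real vec \<Rightarrow> real vec \<Rightarrow> nat list \<Rightarrow> real vec" where
  "embed_seq z u \<alpha> = vec (length \<alpha>) (\<lambda>t. z $ (\<alpha> ! t - 1) + u $ t)"

definition attention :: "real vec \<Rightarrow> real vec \<Rightarrow> nat list \<Rightarrow> real" where
  "attention z u \<alpha> =
     (let x = embed_seq z u \<alpha> in x \<bullet> softmax (x $ (dim_vec x - 1) \<cdot>\<^sub>v x))"

text \<open>A function on $\mathbb R^n$ is real analytic if around every point it is the sum of a power
  series in \<open>n\<close> variables; multi-indices are functions \<open>{..<n} \<rightarrow>\<^sub>E UNIV\<close> into the naturals, and the
  multiple series is summed unconditionally. The polydisc has sup-norm radius \<open>r\<close>.\<close>

definition real_analytic :: "nat \<Rightarrow> (real vec \<Rightarrow> real) \<Rightarrow> bool" where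
  "real_analytic n F \<longleftrightarrow>
     (\<forall>a\<in>carrier_vec n. \<exists>r>0. \<exists>c :: (nat \<Rightarrow> nat) \<Rightarrow> real.
        \<forall>x\<in>carrier_vec n. (\<forall>i<n. \<bar>x $ i - a $ i\<bar> < r) \<longrightarrow>
          ((\<lambda>m. c m * (\<Prod>i<n. (x $ i - a $ i) ^ m i)) has_sum F x) ({..<n} \<rightarrow>\<^sub>E UNIV))"

text \<open>Genericity on $\mathbb R^m \times \mathbb R^n$, which is identified with $\mathbb R^{m+n}$ by
  concatenation.\<close>

definition generic_pair :: "nat \<Rightarrow> nat \<Rightarrow> (real vec \<Rightarrow> real vec \<Rightarrow> bool) \<Rightarrow> bool" where
  "generic_pair m n P \<longleftrightarrow>
     (\<exists>G. real_analytic (m + n) G \<and> (\<exists>p\<in>carrier_vec (m + n). G p \<noteq> 0) \<and>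
        (\<forall>z\<in>carrier_vec m. \<forall>u\<in>carrier_vec n. \<not> P z u \<longrightarrow> G (z @\<^sub>v u) = 0))"

end

(* Write attention z u \<alpha> = N \<alpha> / D \<alpha> with D \<alpha> > 0, where N \<alpha> and D \<alpha> are polynomials in the
   coordinates of (z, u) and in the exponentials of products of two coordinates.  Such functions
   have globally convergent power series, and along real lines they extend to entire functions of
   one complex variable, so a nonzero one has only countably many zeros on a suitable line and
   finite products of nonzero ones are nonzero.  It therefore suffices to make each N \<alpha> and each
   N \<alpha> * D \<beta> - N \<beta> * D \<alpha> nonzero at a point of its own.  For the latter, let u have one huge entry,
   at a position where \<alpha> and \<beta> differ (or at the end of the longer sequence): softmax is then
   close to hardmax, which tells the two sequences apart. *)

theory Submission
  imports Defs "HOL-Complex_Analysis.Conformal_Mappings"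
begin

section \<open>Multivariate power series with infinite radius of convergence\<close>

abbreviation multi_indices :: "nat \<Rightarrow> (nat \<Rightarrow> nat) set" where
  "multi_indices n \<equiv> {..<n} \<rightarrow>\<^sub>E UNIV"

text \<open>One coefficient family serves all \<open>x\<close>, so sums and products need no
  bookkeeping of radii. Points are functions on all naturals, of which only the first
  \<open>n\<close> values enter the series.\<close>

definition entire_series_at :: "nat \<Rightarrow> (nat \<Rightarrow> real) \<Rightarrow> ((nat \<Rightarrow> real) \<Rightarrow> real) \<Rightarrow> bool" where
  "entire_series_at n a F \<longleftrightarrow>
     (\<exists>c. \<forall>x. ((\<lambda>m. c m * (\<Prod>i<n. (x i - a i) ^ m i)) has_sum F x) (multi_indices n))"

lemma entire_series_at_monomial:
  assumes "\<mu> \<in> multi_indices n"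
  shows "entire_series_at n a (\<lambda>x. v * (\<Prod>i<n. (x i - a i) ^ \<mu> i))"
  unfolding entire_series_at_def
proof (intro exI allI)
  fix x
  show "((\<lambda>m. (if m = \<mu> then v else 0) * (\<Prod>i<n. (x i - a i) ^ m i)) has_sum
      v * (\<Prod>i<n. (x i - a i) ^ \<mu> i)) (multi_indices n)"
    by (rule has_sum_finite_neutralI[where B = "{\<mu>}"]) (use assms in auto)
qed

text \<open>The \<open>k\<close>-th term of the exponential series is a multiple of the monomial
  with exponent \<open>k * \<mu>\<close>. Since \<open>\<mu> i \<noteq> 0\<close>, these exponents
  are distinct for distinct \<open>k\<close>, so no two terms share a coefficient.\<close>

lemma entire_series_at_exp_monomial:
  assumes \<mu>: "\<mu> \<in> multi_indices n" and i: "i < n" "\<mu> i \<noteq> 0"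
  shows "entire_series_at n a (\<lambda>x. exp (v * (\<Prod>i<n. (x i - a i) ^ \<mu> i)))"
proof -
  define h where "h k = (\<lambda>j\<in>{..<n}. k * \<mu> j)" for k :: nat
  have inj: "inj h"
  proof (rule injI)
    fix k l assume "h k = h l"
    then have "h k i = h l i" by simp
    then show "k = l" using i by (simp add: h_def)
  qed
  \<comment> \<open>The coefficients live on the multiples of \<open>\<mu>\<close>; inverting
    \<open>h\<close> recovers the index of the exponential series.\<close>
  define c where "c m = (if m \<in> range h then v ^ inv_into UNIV h m / fact (inv_into UNIV h m) else 0)" for m
  have c_h: "c (h k) = v ^ k / fact k" for k
    using inj by (simp add: c_def)
  have "((\<lambda>m. c m * (\<Prod>i<n. (x i - a i) ^ m i)) has_sum
      exp (v * (\<Prod>i<n. (x i - a i) ^ \<mu> i))) (multi_indices n)" for x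
  proof -
    let ?y = "v * (\<Prod>i<n. (x i - a i) ^ \<mu> i)"
    have mono: "(\<Prod>i<n. (x i - a i) ^ h k i) = (\<Prod>i<n. (x i - a i) ^ \<mu> i) ^ k" for k
      by (simp add: h_def prod_power_distrib mult.commute[of k] power_mult)
    have "((\<lambda>k. ?y ^ k /\<^sub>R fact k) has_sum exp ?y) UNIV"
      by (rule norm_summable_imp_has_sum[OF summable_norm_exp exp_converges])
    moreover have "(\<lambda>k. ?y ^ k /\<^sub>R fact k)
        = (\<lambda>m. c m * (\<Prod>i<n. (x i - a i) ^ m i)) \<circ> h"
      by (auto simp: fun_eq_iff c_h mono power_mult_distrib field_simps)
    ultimately have "((\<lambda>m. c m * (\<Prod>i<n. (x i - a i) ^ m i)) has_sum exp ?y) (range h)"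
      using inj by (simp add: has_sum_reindex)
    moreover have "range h \<subseteq> multi_indices n"
      by (simp add: h_def image_subset_iff)
    ultimately show ?thesis
      by (subst has_sum_cong_neutral[where S = "range h" and T = "multi_indices n", symmetric])
        (auto simp: c_def)
  qed
  then show ?thesis unfolding entire_series_at_def by blast
qed

lemma entire_series_at_add:
  assumes "entire_series_at n a F" "entire_series_at n a G"
  shows "entire_series_at n a (\<lambda>x. F x + G x)"
proof -
  obtain c d where
    "\<And>x. ((\<lambda>m. c m * (\<Prod>i<n. (x i - a i) ^ m i)) has_sum F x) (multi_indices n)"
    "\<And>x. ((\<lambda>m. d m * (\<Prod>i<n. (x i - a i) ^ m i)) has_sum G x) (multi_indices n)"
    using assms unfolding entire_series_at_def by blast
  then have "((\<lambda>m. (c m + d m) * (\<Prod>i<n. (x i - a i) ^ m i)) has_sum F x + G x) (multi_indices n)"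
    for x
    unfolding distrib_right by (rule has_sum_add)
  then show ?thesis
    unfolding entire_series_at_def by (intro exI[of _ "\<lambda>m. c m + d m"]) simp
qed

text \<open>Unconditional summability of reals is absolute, so the double family is summable on the
  product set and its sum may be computed iteratedly.\<close>

lemma has_sum_times:
  fixes f :: "'a \<Rightarrow> real" and g :: "'b \<Rightarrow> real"
  assumes f: "(f has_sum S) A" and g: "(g has_sum R) B"
  shows "((\<lambda>(m, l). f m * g l) has_sum S * R) (A \<times> B)"
proof (rule has_sum_SigmaI)
  have "(\<lambda>m. norm (f m)) summable_on A" "(\<lambda>l. norm (g l)) summable_on B"
    by (rule summable_on_iff_abs_summable_on_real[THEN iffD1], rule has_sum_imp_summable, fact f)
      (rule summable_on_iff_abs_summable_on_real[THEN iffD1], rule has_sum_imp_summable, fact g)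
  then have "(\<lambda>l. \<bar>f m\<bar> * \<bar>g l\<bar>) summable_on B"
    "(\<lambda>m. \<bar>f m\<bar> * (\<Sum>\<^sub>\<infinity>l\<in>B. \<bar>g l\<bar>)) summable_on A" for m
    using summable_on_cmult_right[of "\<lambda>l. \<bar>g l\<bar>" B "\<bar>f m\<bar>"]
      summable_on_cmult_left[of "\<lambda>m. \<bar>f m\<bar>" A "\<Sum>\<^sub>\<infinity>l\<in>B. \<bar>g l\<bar>"]
    by simp_all
  moreover have "0 \<le> (\<Sum>\<^sub>\<infinity>l\<in>B. \<bar>g l\<bar>)"
    by (rule infsum_nonneg) simp
  ultimately have "(\<lambda>p. norm (case p of (m, l) \<Rightarrow> f m * g l)) summable_on (A \<times> B)"
    by (subst Infinite_Sum.abs_summable_on_Sigma_iff) (simp add: abs_mult infsum_cmult_right')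
  then show "(\<lambda>(m, l). f m * g l) summable_on (A \<times> B)"
    by (rule abs_summable_summable)
  show "((\<lambda>l. case (m, l) of (m, l) \<Rightarrow> f m * g l) has_sum f m * R) B" for m
    using has_sum_cmult_right[OF g] by simp
  show "((\<lambda>m. f m * R) has_sum S * R) A"
    by (rule has_sum_cmult_left[OF f])
qed

text \<open>Cauchy product: the pairs of multi-indices are grouped by their sum, and all pairs in
  one group carry the same monomial.\<close>

lemma entire_series_at_mult:
  assumes "entire_series_at n a F" "entire_series_at n a G"
  shows "entire_series_at n a (\<lambda>x. F x * G x)"
proof -
  obtain c d where
    c: "\<And>x. ((\<lambda>m. c m * (\<Prod>i<n. (x i - a i) ^ m i)) has_sum F x) (multi_indices n)" and
    d: "\<And>x. ((\<lambda>m. d m * (\<Prod>i<n. (x i - a i) ^ m i)) has_sum G x) (multi_indices n)"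
    using assms unfolding entire_series_at_def by blast
  define A where "A = multi_indices n"
  define B where "B k = {(m, l) \<in> A \<times> A. k = (\<lambda>i\<in>{..<n}. m i + l i)}" for k
  define e where "e k = (\<Sum>\<^sub>\<infinity>(m, l)\<in>B k. c m * d l)" for k
  have "((\<lambda>k. e k * (\<Prod>i<n. (x i - a i) ^ k i)) has_sum F x * G x) A" for x
  proof -
    let ?p = "\<lambda>m. \<Prod>i<n. (x i - a i) ^ m i"
    let ?f = "\<lambda>(m, l). (c m * ?p m) * (d l * ?p l)"
    have prod: "(?f has_sum F x * G x) (A \<times> A)"
      unfolding A_def by (rule has_sum_times[OF c d])
    have closed: "(\<lambda>i\<in>{..<n}. m i + l i) \<in> A" for m l :: "nat \<Rightarrow> nat"
      by (simp add: A_def)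
    \<comment> \<open>The fibres \<open>B k\<close> of addition partition
      \<open>A \<times> A\<close>, so summing over the pairs is summing over the fibres
      first.\<close>
    have bij: "bij_betw snd (Sigma A B) (A \<times> A)"
      by (rule bij_betwI[where g = "\<lambda>(m, l). (\<lambda>i\<in>{..<n}. m i + l i, m, l)"])
        (auto simp: B_def closed)
    have "((\<lambda>p. ?f (snd p)) has_sum F x * G x) (Sigma A B)"
      using prod by (simp add: has_sum_reindex_bij_betw[OF bij])
    moreover have "((\<lambda>q. ?f (snd (k, q))) has_sum e k * ?p k) (B k)" for k
    proof -
      have "?f summable_on B k"
        by (rule summable_on_subset_banach[OF has_sum_imp_summable[OF prod]]) (auto simp: B_def)
      then have "(?f has_sum infsum ?f (B k)) (B k)"
        by (rule has_sum_infsum)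
      also have "infsum ?f (B k) = (\<Sum>\<^sub>\<infinity>q\<in>B k. (case q of (m, l) \<Rightarrow> c m * d l) * ?p k)"
        by (rule infsum_cong) (auto simp: B_def power_add prod.distrib)
      also have "\<dots> = e k * ?p k"
        unfolding e_def by (rule infsum_cmult_left')
      finally show ?thesis by simp
    qed
    ultimately show ?thesis
      by (rule has_sum_SigmaD)
  qed
  then show ?thesis unfolding entire_series_at_def A_def by blast
qed

lemma entire_series_at_const: "entire_series_at n a (\<lambda>_. v)"
  using entire_series_at_monomial[of "\<lambda>i\<in>{..<n}. 0" n a v] by simp

lemma prod_power_delta:
  fixes y :: "nat \<Rightarrow> real"
  assumes "i < n"
  shows "(\<Prod>j<n. y j ^ (if j = i then 1 else 0 :: nat)) = y i"
proof -
  have "(\<Prod>j<n. y j ^ (if j = i then 1 else 0)) = (\<Prod>j<n. if j = i then y j else 1)"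
    by (rule prod.cong) auto
  then show ?thesis using assms by simp
qed

lemma entire_series_at_coord:
  assumes "i < n"
  shows "entire_series_at n a (\<lambda>x. x i)"
proof -
  have "(\<Prod>j<n. (x j - a j) ^ (\<lambda>j\<in>{..<n}. if j = i then 1 else 0) j) = x i - a i" for x
    using prod_power_delta[OF assms, of "\<lambda>j. x j - a j"] by simp
  then have "entire_series_at n a (\<lambda>x. x i - a i)"
    using entire_series_at_monomial[of "\<lambda>j\<in>{..<n}. if j = i then 1 else 0" n a 1] by simp
  from entire_series_at_add[OF this entire_series_at_const[of n a "a i"]] show ?thesis by simp
qed

lemma entire_series_at_exp_coord:
  assumes "i < n"
  shows "entire_series_at n a (\<lambda>x. exp (v * (x i - a i)))"
proof -
  have "(\<Prod>j<n. (x j - a j) ^ (\<lambda>j\<in>{..<n}. if j = i then 1 else 0) j) = x i - a i" for x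
    using prod_power_delta[OF assms, of "\<lambda>j. x j - a j"] by simp
  then show ?thesis
    using entire_series_at_exp_monomial[of "\<lambda>j\<in>{..<n}. if j = i then 1 else 0" n i a v] assms by simp
qed

text \<open>Re-centring at \<open>a\<close>: \<open>x i * x j\<close> is the sum of
  \<open>a i * a j\<close>, \<open>a i * (x j - a j)\<close>, \<open>a j * (x i - a i)\<close> and
  \<open>(x i - a i) * (x j - a j)\<close>, and the exponential of each has a series at
  \<open>a\<close>.\<close>

lemma entire_series_at_exp_coord_mult:
  assumes "i < n" "j < n"
  shows "entire_series_at n a (\<lambda>x. exp (x i * x j))"
proof -
  \<comment> \<open>Adding two indicators also covers \<open>i = j\<close>, where the exponent must
    be 2.\<close>
  define \<mu> where "\<mu> = (\<lambda>k\<in>{..<n}. (if k = i then 1 else 0) + (if k = j then 1 else 0 :: nat))"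
  have "(\<Prod>k<n. (x k - a k) ^ \<mu> k) = (x i - a i) * (x j - a j)" for x
    using prod_power_delta[OF assms(1), of "\<lambda>j. x j - a j"]
      prod_power_delta[OF assms(2), of "\<lambda>j. x j - a j"]
    by (simp add: \<mu>_def power_add prod.distrib del: power_0 power_one_right)
  then have "entire_series_at n a (\<lambda>x. exp ((x i - a i) * (x j - a j)))"
    using entire_series_at_exp_monomial[of \<mu> n i a 1] assms by (simp add: \<mu>_def)
  from entire_series_at_mult[OF
      entire_series_at_mult[OF entire_series_at_const[of n a "exp (a i * a j)"]
        entire_series_at_exp_coord[OF assms(2), of a "a i"]]
      entire_series_at_mult[OF entire_series_at_exp_coord[OF assms(1), of a "a j"] this]]
  show ?thesis by (simp add: exp_add[symmetric] algebra_simps)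
qed

section \<open>Exponential polynomials\<close>

text \<open>Exponents are products of two coordinates because softmax is applied to the last entry
  times each entry. Division is left out, so that both the power series and the extension to complex
  arguments exist globally.\<close>

inductive exp_poly :: "nat \<Rightarrow> ((nat \<Rightarrow> real) \<Rightarrow> real) \<Rightarrow> bool" for n where
  const: "exp_poly n (\<lambda>_. v)"
| coord: "i < n \<Longrightarrow> exp_poly n (\<lambda>x. x i)"
| exp: "i < n \<Longrightarrow> j < n \<Longrightarrow> exp_poly n (\<lambda>x. exp (x i * x j))"
| add: "exp_poly n F \<Longrightarrow> exp_poly n G \<Longrightarrow> exp_poly n (\<lambda>x. F x + G x)"
| mult: "exp_poly n F \<Longrightarrow> exp_poly n G \<Longrightarrow> exp_poly n (\<lambda>x. F x * G x)"

lemma exp_poly_diff: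
  assumes "exp_poly n F" "exp_poly n G"
  shows "exp_poly n (\<lambda>x. F x - G x)"
  using exp_poly.add[OF assms(1) exp_poly.mult[OF exp_poly.const[of n "-1"] assms(2)]] by simp

lemma exp_poly_sum:
  "(\<And>k. k \<in> K \<Longrightarrow> exp_poly n (F k)) \<Longrightarrow> exp_poly n (\<lambda>x. \<Sum>k\<in>K. F k x)"
  by (induction K rule: infinite_finite_induct) (auto intro: exp_poly.intros)

lemma exp_poly_prod:
  "(\<And>k. k \<in> K \<Longrightarrow> exp_poly n (F k)) \<Longrightarrow> exp_poly n (\<lambda>x. \<Prod>k\<in>K. F k x)"
  by (induction K rule: infinite_finite_induct) (auto intro: exp_poly.intros)

lemma exp_poly_imp_entire_series_at: "exp_poly n F \<Longrightarrow> entire_series_at n a F"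
  by (induction rule: exp_poly.induct)
    (auto intro: entire_series_at_const entire_series_at_coord entire_series_at_exp_coord_mult
      entire_series_at_add entire_series_at_mult)

lemma real_analytic_exp_poly:
  assumes "exp_poly n F"
  shows "real_analytic n (\<lambda>v. F (vec_index v))"
  unfolding real_analytic_def
proof (intro ballI)
  fix a :: "real Matrix.vec"
  obtain c where "\<And>x. ((\<lambda>m. c m * (\<Prod>i<n. (x i - vec_index a i) ^ m i)) has_sum F x)
      (multi_indices n)"
    using exp_poly_imp_entire_series_at[OF assms, of "vec_index a"]
    unfolding entire_series_at_def by blast
  then show "\<exists>r>0. \<exists>c. \<forall>x\<in>carrier_vec n. (\<forall>i<n. \<bar>vec_index x i - vec_index a i\<bar> < r) \<longrightarrow>
      ((\<lambda>m. c m * (\<Prod>i<n. (vec_index x i - vec_index a i) ^ m i)) has_sum F (vec_index x))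
        (multi_indices n)"
    \<comment> \<open>The series converges everywhere, so the radius 1 is an arbitrary
      choice.\<close>
    by (intro exI[of _ "1::real"] exI[of _ c]) auto
qed

section \<open>Zeros of exponential polynomials along real lines\<close>

lemma exp_poly_on_line:
  assumes "exp_poly n F"
  shows "\<exists>h. h holomorphic_on UNIV \<and>
    (\<forall>t. h (complex_of_real t) = complex_of_real (F (\<lambda>i. p i + t * d i)))"
  using assms
proof (induction rule: exp_poly.induct)
  case (const v)
  then show ?case by (intro exI[of _ "\<lambda>_. of_real v"]) auto
next
  case (coord i)
  show ?case
    by (intro exI[of _ "\<lambda>z. of_real (p i) + z * of_real (d i)"]) (auto intro!: holomorphic_intros)
next
  case (exp i j)
  show ?case
    by (intro exI[of _ "\<lambda>z. exp ((of_real (p i) + z * of_real (d i)) * (of_real (p j) + z * of_real (d j)))"])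
      (auto intro!: holomorphic_intros simp: exp_of_real[symmetric])
next
  case (add F G)
  then obtain h k where "h holomorphic_on UNIV" "k holomorphic_on UNIV"
    "\<And>t. h (complex_of_real t) = complex_of_real (F (\<lambda>i. p i + t * d i))"
    "\<And>t. k (complex_of_real t) = complex_of_real (G (\<lambda>i. p i + t * d i))"
    by blast
  then show ?case
    by (intro exI[of _ "\<lambda>z. h z + k z"]) (auto intro!: holomorphic_intros)
next
  case (mult F G)
  then obtain h k where "h holomorphic_on UNIV" "k holomorphic_on UNIV"
    "\<And>t. h (complex_of_real t) = complex_of_real (F (\<lambda>i. p i + t * d i))"
    "\<And>t. k (complex_of_real t) = complex_of_real (G (\<lambda>i. p i + t * d i))"
    by blast
  then show ?case
    by (intro exI[of _ "\<lambda>z. h z * k z"]) (auto intro!: holomorphic_intros)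
qed

text \<open>The restriction to the line extends to an entire function. A nonconstant one has
  countably many zeros, and a constant one has none because of its value at
  \<open>t\<^sub>0\<close>.\<close>

lemma exp_poly_countable_zeros_on_line:
  assumes "exp_poly n F" and nz: "F (\<lambda>i. p i + t\<^sub>0 * d i) \<noteq> 0"
  shows "countable {t. F (\<lambda>i. p i + t * d i) = 0}"
proof -
  obtain h where h: "h holomorphic_on UNIV"
    "\<And>t. h (complex_of_real t) = complex_of_real (F (\<lambda>i. p i + t * d i))"
    using exp_poly_on_line[OF assms(1)] by blast
  have eq: "complex_of_real ` {t. F (\<lambda>i. p i + t * d i) = 0} \<subseteq> {z. h z = 0}"
    using h(2) by auto
  have "countable {z. h z = 0}"
  proof (cases "h constant_on UNIV")
    case True
    then have "h z \<noteq> 0" for z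
      using h(2)[of t\<^sub>0] nz unfolding constant_on_def by (metis UNIV_I of_real_eq_0_iff)
    then show ?thesis by simp
  next
    case False
    then show ?thesis
      using holomorphic_countable_zeros[OF h(1)] by (simp add: connected_UNIV)
  qed
  then show ?thesis
    using countable_subset[OF eq] countable_image_inj_on[of complex_of_real] inj_of_real
    by (metis inj_on_subset subset_UNIV)
qed

text \<open>The line through \<open>p\<close> (at parameter 0) and \<open>q\<close> (at parameter 1)
  meets each zero set in a countable set, and two countable sets do not exhaust the reals.\<close>

lemma exp_poly_mult_nonzero:
  assumes "exp_poly n F" "exp_poly n G" "F p \<noteq> 0" "G q \<noteq> 0"
  shows "\<exists>r. F r * G r \<noteq> 0"
proof -
  define l where "l t = (\<lambda>i. p i + t * (q i - p i))" for t
  have "countable {t. F (l t) = 0}"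
    unfolding l_def by (rule exp_poly_countable_zeros_on_line[OF assms(1), of _ 0]) (use assms in auto)
  moreover have "countable {t. G (l t) = 0}"
    unfolding l_def by (rule exp_poly_countable_zeros_on_line[OF assms(2), of _ 1]) (use assms in auto)
  ultimately have "{t. F (l t) = 0} \<union> {t. G (l t) = 0} \<noteq> (UNIV :: real set)"
    using uncountable_UNIV_real by (metis countable_Un)
  then show ?thesis by auto
qed

lemma exp_poly_prod_nonzero:
  assumes "finite K" "\<And>k. k \<in> K \<Longrightarrow> exp_poly n (F k)" "\<And>k. k \<in> K \<Longrightarrow> \<exists>p. F k p \<noteq> 0"
  shows "\<exists>p. (\<Prod>k\<in>K. F k p) \<noteq> 0"
  using assms
proof (induction K)
  case (insert k K)
  then obtain p q where "F k p \<noteq> 0" "(\<Prod>k\<in>K. F k q) \<noteq> 0" by blast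
  then have "\<exists>r. F k r * (\<Prod>k\<in>K. F k r) \<noteq> 0"
    by (rule exp_poly_mult_nonzero[rotated 2]) (use insert in \<open>auto intro: exp_poly_prod\<close>)
  then show ?case using insert.hyps by simp
qed auto

section \<open>Softmax averages\<close>

text \<open>As \<open>x (n - 1)\<close> is the last entry, this over
  \<open>softmax_denom x n\<close> is the inner product of \<open>x\<close> with the softmax of its
  multiple by that entry.\<close>

definition softmax_numer :: "(nat \<Rightarrow> real) \<Rightarrow> nat \<Rightarrow> real" where
  "softmax_numer x n = (\<Sum>j<n. x j * exp (x (n - 1) * x j))"

definition softmax_denom :: "(nat \<Rightarrow> real) \<Rightarrow> nat \<Rightarrow> real" where
  "softmax_denom x n = (\<Sum>j<n. exp (x (n - 1) * x j))"

lemma softmax_denom_pos: "0 < n \<Longrightarrow> softmax_denom x n > 0"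
  unfolding softmax_denom_def by (rule sum_pos) auto

lemma softmax_numer_pos: "0 < n \<Longrightarrow> (\<And>j. j < n \<Longrightarrow> x j > 0) \<Longrightarrow> softmax_numer x n > 0"
  unfolding softmax_numer_def by (rule sum_pos) auto

text \<open>A weighted average does not exceed an upper bound of its entries; the denominator is
  cleared.\<close>

lemma softmax_numer_le:
  assumes "\<And>j. j < n \<Longrightarrow> x j \<le> b"
  shows "softmax_numer x n \<le> b * softmax_denom x n"
  unfolding softmax_numer_def softmax_denom_def sum_distrib_left
  by (rule sum_mono) (use assms in auto)

text \<open>By the quadratic Taylor bound \<open>exp y\<close> is at least
  \<open>y\<^sup>2 / 2\<close>, so the left side is at most \<open>2 / y\<close>.\<close>

lemma mult_exp_minus_le:
  fixes y :: real
  assumes "0 < K" "K \<le> y"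
  shows "y * exp (- y) \<le> 2 / K"
proof -
  have "y\<^sup>2 / 2 \<le> exp y"
    using exp_lower_Taylor_quadratic[of y] assms by simp
  then have "K * y \<le> 2 * exp y"
    using mult_right_mono[OF assms(2), of y] assms unfolding power2_eq_square by linarith
  then show ?thesis
    using assms(1) by (simp add: exp_minus field_simps)
qed

text \<open>With an attention scale of at least 1, softmax is close to hardmax as soon as one entry
  dominates all others by a large gap.\<close>

lemma softmax_numer_ge:
  assumes t: "t < n" and l: "1 \<le> x (n - 1)" and K: "0 < K"
    and gap: "\<And>j. j < n \<Longrightarrow> j \<noteq> t \<Longrightarrow> x j + K \<le> x t"
  shows "(x t - 2 * real n / K) * softmax_denom x n \<le> softmax_numer x n"
proof -
  let ?l = "x (n - 1)" and ?D = "softmax_denom x n"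
  have D: "exp (?l * x t) \<le> ?D"
    unfolding softmax_denom_def by (rule member_le_sum) (use t in auto)
  \<comment> \<open>The average falls short of \<open>x t\<close> by the weighted mean of the gaps
    \<open>x t - x j\<close>. Each of the \<open>n\<close> terms contributes at most
    \<open>2 / K\<close>.\<close>
  have "(x t - x j) * exp (?l * x j) \<le> 2 / K * ?D" if "j < n" for j
  proof (cases "j = t")
    case True
    then show ?thesis using K softmax_denom_pos[of n x] t by (auto intro: less_imp_le)
  next
    case False
    let ?y = "x t - x j"
    have y: "K \<le> ?y" using gap[OF that False] by simp
    have "?y * exp (?l * x j) = ?y * exp (- (?l * ?y)) * exp (?l * x t)"
      by (simp add: exp_add[symmetric] algebra_simps)
    \<comment> \<open>The scale \<open>?l\<close> is at least 1, so lowering it to 1 only increases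
      the exponential.\<close>
    also have "\<dots> \<le> ?y * exp (- ?y) * exp (?l * x t)"
    proof -
      have "?y \<le> ?l * ?y"
        using mult_right_mono[OF l, of ?y] y K by simp
      then have "exp (- (?l * ?y)) \<le> exp (- ?y)"
        by (simp only: exp_le_cancel_iff neg_le_iff_le)
      then show ?thesis
        using y K by (intro mult_right_mono mult_left_mono) auto
    qed
    also have "\<dots> \<le> 2 / K * ?D"
      using mult_exp_minus_le[OF K y] D K by (intro mult_mono) auto
    finally show ?thesis .
  qed
  then have "(\<Sum>j<n. (x t - x j) * exp (?l * x j)) \<le> (\<Sum>j<n. 2 / K * ?D)"
    by (intro sum_mono) auto
  moreover have "(\<Sum>j<n. (x t - x j) * exp (?l * x j)) = x t * ?D - softmax_numer x n"
    by (simp add: softmax_numer_def softmax_denom_def sum_subtractf sum_distrib_left left_diff_distrib)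
  ultimately show ?thesis by (simp add: algebra_simps)
qed

section \<open>Separating token sequences\<close>

text \<open>A single point \<open>p\<close> stands for the concatenation of \<open>z\<close> and
  \<open>u\<close>, so \<open>u\<close> starts at index \<open>\<zeta>\<close>; tokens count from 1,
  positions from 0.\<close>

definition embed_entry :: "nat \<Rightarrow> nat list \<Rightarrow> (nat \<Rightarrow> real) \<Rightarrow> nat \<Rightarrow> real" where
  "embed_entry \<zeta> \<alpha> p t = p (\<alpha> ! t - 1) + p (\<zeta> + t)"

definition attn_numer :: "nat \<Rightarrow> nat list \<Rightarrow> (nat \<Rightarrow> real) \<Rightarrow> real" where
  "attn_numer \<zeta> \<alpha> p = softmax_numer (embed_entry \<zeta> \<alpha> p) (length \<alpha>)"

definition attn_denom :: "nat \<Rightarrow> nat list \<Rightarrow> (nat \<Rightarrow> real) \<Rightarrow> real" where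
  "attn_denom \<zeta> \<alpha> p = softmax_denom (embed_entry \<zeta> \<alpha> p) (length \<alpha>)"

lemma token_seqsD:
  assumes "\<alpha> \<in> token_seqs \<zeta> T"
  shows "0 < length \<alpha>" "length \<alpha> \<le> T" "\<And>t. t < length \<alpha> \<Longrightarrow> 1 \<le> \<alpha> ! t \<and> \<alpha> ! t \<le> \<zeta>"
  using assms by (auto simp: token_seqs_def subset_iff)

lemma finite_token_seqs: "finite (token_seqs \<zeta> T)"
proof -
  have "finite {\<alpha>. length \<alpha> = t \<and> set \<alpha> \<subseteq> {1..\<zeta>}}" for t
    using finite_lists_length_eq[of "{1..\<zeta>}" t] by (simp add: conj_commute)
  then show ?thesis by (simp add: token_seqs_def)
qed

section \<open>Attention as a quotient of exponential polynomials\<close>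

lemma attention_eq:
  assumes "\<alpha> \<in> token_seqs \<zeta> T" and z: "z \<in> carrier_vec \<zeta>" and u: "u \<in> carrier_vec T"
  defines "p \<equiv> vec_index (z @\<^sub>v u)"
  shows "attention z u \<alpha> = attn_numer \<zeta> \<alpha> p / attn_denom \<zeta> \<alpha> p"
proof -
  note \<alpha> = token_seqsD[OF assms(1)]
  let ?x = "embed_entry \<zeta> \<alpha> p"
  have entry: "vec_index (embed_seq z u \<alpha>) t = ?x t" if "t < length \<alpha>" for t
    using that \<alpha>(2) \<alpha>(3)[OF that] z u by (auto simp: embed_seq_def embed_entry_def p_def)
  have "dim_vec (embed_seq z u \<alpha>) = length \<alpha>"
    by (simp add: embed_seq_def)
  then have "attention z u \<alpha> =
      (\<Sum>i<length \<alpha>. ?x i * (exp (?x (length \<alpha> - 1) * ?x i) /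
        (\<Sum>j<length \<alpha>. exp (?x (length \<alpha> - 1) * ?x j))))"
    using \<alpha>(1)
    by (simp add: attention_def Let_def scalar_prod_def softmax_def entry lessThan_atLeast0)
  then show ?thesis
    by (simp add: attn_numer_def attn_denom_def softmax_numer_def softmax_denom_def sum_divide_distrib)
qed

text \<open>Each entry is a sum of two coordinates, so the product of two entries expands into four
  products of two coordinates.\<close>

lemma exp_poly_exp_embed_entry:
  assumes "\<alpha> \<in> token_seqs \<zeta> T" "s < length \<alpha>" "t < length \<alpha>"
  shows "exp_poly (\<zeta> + T) (\<lambda>p. exp (embed_entry \<zeta> \<alpha> p s * embed_entry \<zeta> \<alpha> p t))"
proof -
  note \<alpha> = token_seqsD[OF assms(1)]
  let ?a = "\<alpha> ! s - 1" and ?b = "\<alpha> ! t - 1"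
  have lt: "?a < \<zeta> + T" "?b < \<zeta> + T" "\<zeta> + s < \<zeta> + T" "\<zeta> + t < \<zeta> + T"
    using \<alpha>(2) \<alpha>(3)[OF assms(2)] \<alpha>(3)[OF assms(3)] assms(2,3) by linarith+
  have "exp_poly (\<zeta> + T) (\<lambda>p. (exp (p ?a * p ?b) * exp (p ?a * p (\<zeta> + t))) *
      (exp (p (\<zeta> + s) * p ?b) * exp (p (\<zeta> + s) * p (\<zeta> + t))))"
    by (intro exp_poly.mult exp_poly.exp lt)
  then show ?thesis
    by (simp add: embed_entry_def exp_add[symmetric] algebra_simps)
qed

lemma exp_poly_attn_denom:
  assumes "\<alpha> \<in> token_seqs \<zeta> T"
  shows "exp_poly (\<zeta> + T) (attn_denom \<zeta> \<alpha>)"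
  unfolding attn_denom_def softmax_denom_def
  using token_seqsD(1)[OF assms] by (intro exp_poly_sum exp_poly_exp_embed_entry[OF assms]) auto

lemma exp_poly_attn_numer:
  assumes "\<alpha> \<in> token_seqs \<zeta> T"
  shows "exp_poly (\<zeta> + T) (attn_numer \<zeta> \<alpha>)"
proof -
  note \<alpha> = token_seqsD[OF assms]
  have "exp_poly (\<zeta> + T) (\<lambda>p. embed_entry \<zeta> \<alpha> p t)" if "t < length \<alpha>" for t
    unfolding embed_entry_def
    using \<alpha>(2) \<alpha>(3)[OF that] that by (intro exp_poly.add exp_poly.coord) linarith+
  then show ?thesis
    unfolding attn_numer_def softmax_numer_def
    using \<alpha>(1) by (intro exp_poly_sum exp_poly.mult exp_poly_exp_embed_entry[OF assms]) auto
qed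

lemma attn_denom_pos: "\<alpha> \<in> token_seqs \<zeta> T \<Longrightarrow> attn_denom \<zeta> \<alpha> p > 0"
  unfolding attn_denom_def by (rule softmax_denom_pos) (rule token_seqsD)

section \<open>Points where numerators and cross differences do not vanish\<close>

lemma attn_numer_nonzero:
  assumes "\<alpha> \<in> token_seqs \<zeta> T"
  shows "\<exists>p. attn_numer \<zeta> \<alpha> p \<noteq> 0"
proof
  \<comment> \<open>All embedded entries equal 2 here, so every summand is positive.\<close>
  show "attn_numer \<zeta> \<alpha> (\<lambda>_. 1) \<noteq> 0"
    using softmax_numer_pos[OF token_seqsD(1)[OF assms], of "embed_entry \<zeta> \<alpha> (\<lambda>_. 1)"]
    by (simp add: attn_numer_def embed_entry_def)
qed

text \<open>Position \<open>t\<close> receives the large value \<open>s\<close>, every other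
  position 1, and token \<open>a\<close> a bonus of 1. Taking \<open>a = 0\<close> gives no bonus,
  as tokens start at 1.\<close>

definition peak_point :: "nat \<Rightarrow> nat \<Rightarrow> nat \<Rightarrow> real \<Rightarrow> nat \<Rightarrow> real" where
  "peak_point \<zeta> a t s i =
     (if i < \<zeta> then (if Suc i = a then 1 else 0) else if i = \<zeta> + t then s else 1)"

lemma embed_entry_peak_point:
  assumes "\<alpha> \<in> token_seqs \<zeta> T" "j < length \<alpha>"
  shows "embed_entry \<zeta> \<alpha> (peak_point \<zeta> a t s) j =
    of_bool (\<alpha> ! j = a) + (if j = t then s else 1)"
  using token_seqsD(3)[OF assms] by (auto simp: embed_entry_def peak_point_def)

text \<open>A sequence that ends before the peak has only entries 1 and 2.\<close>

lemma attn_peak_point_small: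
  assumes "\<alpha> \<in> token_seqs \<zeta> T" "length \<alpha> \<le> t"
  shows "attn_numer \<zeta> \<alpha> (peak_point \<zeta> a t s) \<le> 2 * attn_denom \<zeta> \<alpha> (peak_point \<zeta> a t s)"
  unfolding attn_numer_def attn_denom_def
  by (rule softmax_numer_le) (use assms in \<open>auto simp: embed_entry_peak_point\<close>)

text \<open>The average lies within \<open>1 / 4\<close> below the peak entry, an error too small to
  hide the token bonus of 1.\<close>

lemma attn_peak_point_bounds:
  assumes \<alpha>: "\<alpha> \<in> token_seqs \<zeta> T" "t < length \<alpha>" and s: "8 * real T + 3 \<le> s"
  shows "attn_numer \<zeta> \<alpha> (peak_point \<zeta> a t s) \<le>
      (s + of_bool (\<alpha> ! t = a)) * attn_denom \<zeta> \<alpha> (peak_point \<zeta> a t s)"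
    and "(s + of_bool (\<alpha> ! t = a) - 1 / 4) * attn_denom \<zeta> \<alpha> (peak_point \<zeta> a t s) \<le>
      attn_numer \<zeta> \<alpha> (peak_point \<zeta> a t s)"
proof -
  note \<alpha>' = token_seqsD[OF \<alpha>(1)]
  let ?x = "embed_entry \<zeta> \<alpha> (peak_point \<zeta> a t s)" and ?n = "length \<alpha>"
  note x = embed_entry_peak_point[OF \<alpha>(1)]
  have T: "0 < T" using \<alpha>' by linarith
  show "attn_numer \<zeta> \<alpha> (peak_point \<zeta> a t s) \<le>
      (s + of_bool (\<alpha> ! t = a)) * attn_denom \<zeta> \<alpha> (peak_point \<zeta> a t s)"
    unfolding attn_numer_def attn_denom_def
    by (rule softmax_numer_le) (use s T in \<open>auto simp: x of_bool_def\<close>)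
  \<comment> \<open>The gap is taken as \<open>K = 8 * T\<close>: entries off the peak are at most
    2, while \<open>s\<close> is at least \<open>8 * T + 3\<close>. As \<open>?n \<le> T\<close>,
    the error \<open>2 * ?n / K\<close> is at most \<open>1 / 4\<close>.\<close>
  have "(?x t - 2 * real ?n / (8 * real T)) * softmax_denom ?x ?n \<le> softmax_numer ?x ?n"
    by (rule softmax_numer_ge) (use s T \<alpha> \<alpha>' in \<open>auto simp: x of_bool_def\<close>)
  moreover have "(s + of_bool (\<alpha> ! t = a) - 1 / 4) * softmax_denom ?x ?n
      \<le> (?x t - 2 * real ?n / (8 * real T)) * softmax_denom ?x ?n"
    using T \<alpha> \<alpha>'(1,2) softmax_denom_pos[of ?n ?x]
    by (intro mult_right_mono) (auto simp: x field_simps)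
  ultimately show "(s + of_bool (\<alpha> ! t = a) - 1 / 4) * attn_denom \<zeta> \<alpha> (peak_point \<zeta> a t s) \<le>
      attn_numer \<zeta> \<alpha> (peak_point \<zeta> a t s)"
    unfolding attn_numer_def attn_denom_def by linarith
qed

text \<open>The quotients satisfy \<open>N / D \<le> a < b \<le> N' / D'\<close>, here with
  denominators cleared.\<close>

lemma cross_mult_neq:
  fixes a b N D N' D' :: real
  assumes "N \<le> a * D" "b * D' \<le> N'" "a < b" "0 < D" "0 < D'"
  shows "N * D' \<noteq> N' * D"
proof -
  have "N * D' \<le> a * D * D'" using assms by simp
  also have "\<dots> < b * D' * D" using assms by (simp add: mult.commute mult.left_commute)
  also have "\<dots> \<le> N' * D" using assms by simp
  finally show ?thesis by simp
qed

lemma attn_separated_aux: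
  assumes \<alpha>: "\<alpha> \<in> token_seqs \<zeta> T" and \<beta>: "\<beta> \<in> token_seqs \<zeta> T" and "\<alpha> \<noteq> \<beta>"
    and le: "length \<alpha> \<le> length \<beta>"
  shows "\<exists>p. attn_numer \<zeta> \<alpha> p * attn_denom \<zeta> \<beta> p \<noteq> attn_numer \<zeta> \<beta> p * attn_denom \<zeta> \<alpha> p"
proof -
  let ?s = "8 * real T + 3"
  note pos = attn_denom_pos[OF \<alpha>] attn_denom_pos[OF \<beta>]
  show ?thesis
  proof (cases "length \<alpha> = length \<beta>")
    case True
    then obtain t where t: "t < length \<alpha>" "\<alpha> ! t \<noteq> \<beta> ! t"
      using \<open>\<alpha> \<noteq> \<beta>\<close> nth_equalityI by blast
    \<comment> \<open>At position \<open>t\<close> only \<open>\<beta>\<close> carries the bonus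
      token, so the quotient for \<open>\<alpha>\<close> is at most \<open>?s\<close> and that for
      \<open>\<beta>\<close> at least \<open>?s + 3 / 4\<close>.\<close>
    let ?p = "peak_point \<zeta> (\<beta> ! t) t ?s"
    have "attn_numer \<zeta> \<alpha> ?p \<le> ?s * attn_denom \<zeta> \<alpha> ?p"
      using attn_peak_point_bounds(1)[OF \<alpha> t(1), of ?s "\<beta> ! t"] t by simp
    moreover have "(?s + 3 / 4) * attn_denom \<zeta> \<beta> ?p \<le> attn_numer \<zeta> \<beta> ?p"
      using attn_peak_point_bounds(2)[OF \<beta>, of t ?s "\<beta> ! t"] t True by simp
    ultimately show ?thesis
      by (intro exI[of _ ?p] cross_mult_neq[OF _ _ _ pos]) auto
  next
    case False
    define t where "t = length \<beta> - 1"
    have t: "length \<alpha> \<le> t" "t < length \<beta>" using le False by (auto simp: t_def)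
    \<comment> \<open>The peak lies past the end of \<open>\<alpha>\<close>: its quotient is at most
      2, while that of \<open>\<beta>\<close> is at least \<open>?s - 1 / 4\<close>.\<close>
    let ?p = "peak_point \<zeta> 0 t ?s"
    have "(?s - 1 / 4) * attn_denom \<zeta> \<beta> ?p \<le> attn_numer \<zeta> \<beta> ?p"
      using attn_peak_point_bounds(2)[OF \<beta> t(2), of ?s 0] token_seqsD(3)[OF \<beta> t(2)] by simp
    then show ?thesis
      by (intro exI[of _ ?p] cross_mult_neq[OF attn_peak_point_small[OF \<alpha> t(1)] _ _ pos]) auto
  qed
qed

lemma attn_separated:
  assumes "\<alpha> \<in> token_seqs \<zeta> T" "\<beta> \<in> token_seqs \<zeta> T" "\<alpha> \<noteq> \<beta>"
  shows "\<exists>p. attn_numer \<zeta> \<alpha> p * attn_denom \<zeta> \<beta> p - attn_numer \<zeta> \<beta> p * attn_denom \<zeta> \<alpha> p \<noteq> 0"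
  using attn_separated_aux[OF assms] attn_separated_aux[OF assms(2,1) not_sym[OF assms(3)]]
    le_cases[of "length \<alpha>" "length \<beta>"]
  by (metis eq_iff_diff_eq_0)

section \<open>The analytic function that vanishes at all exceptional points\<close>

theorem theorem17:
  fixes \<zeta> T :: nat
  shows "generic_pair \<zeta> T (\<lambda>z u.
    inj_on (attention z u) (token_seqs \<zeta> T) \<and>
    attention z u ` token_seqs \<zeta> T \<subseteq> UNIV - {0})"
proof -
  define S where "S = token_seqs \<zeta> T"
  define P where "P = {(\<alpha>, \<beta>) \<in> S \<times> S. \<alpha> \<noteq> \<beta>}"
  define N where "N = attn_numer \<zeta>"
  define D where "D = attn_denom \<zeta>"
  define E where "E = (\<lambda>(\<alpha>, \<beta>) p. N \<alpha> p * D \<beta> p - N \<beta> p * D \<alpha> p)"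
  \<comment> \<open>The first product vanishes when some attention value is 0, the second when two
    distinct sequences share a value. With no sequences both products are empty and \<open>F\<close>
    is 1.\<close>
  define F where "F p = (\<Prod>\<alpha>\<in>S. N \<alpha> p) * (\<Prod>q\<in>P. E q p)" for p
  have fin: "finite S" "finite P"
    by (auto simp: S_def P_def finite_token_seqs intro: finite_subset[of _ "S \<times> S"])
  have N: "exp_poly (\<zeta> + T) (N \<alpha>)" and D: "exp_poly (\<zeta> + T) (D \<alpha>)" if "\<alpha> \<in> S" for \<alpha>
    using that by (simp_all add: S_def N_def D_def exp_poly_attn_numer exp_poly_attn_denom)
  have E: "exp_poly (\<zeta> + T) (E q)" if "q \<in> P" for q
    using that by (auto simp: P_def E_def N D intro!: exp_poly_diff exp_poly.mult)
  have F: "exp_poly (\<zeta> + T) F"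
    unfolding F_def by (intro exp_poly.mult exp_poly_prod N E)
  have "\<exists>p. (\<Prod>\<alpha>\<in>S. N \<alpha> p) \<noteq> 0"
    by (rule exp_poly_prod_nonzero[OF fin(1) N]) (auto simp: S_def N_def attn_numer_nonzero)
  moreover have "\<exists>p. (\<Prod>q\<in>P. E q p) \<noteq> 0"
    by (rule exp_poly_prod_nonzero[OF fin(2) E])
      (use attn_separated in \<open>auto simp: P_def S_def E_def N_def D_def\<close>)
  ultimately obtain p q where "(\<Prod>\<alpha>\<in>S. N \<alpha> p) \<noteq> 0" "(\<Prod>q'\<in>P. E q' q) \<noteq> 0" by blast
  then have "\<exists>r. F r \<noteq> 0"
    unfolding F_def
    by (intro exp_poly_mult_nonzero[where n = "\<zeta> + T" and F = "\<lambda>p. \<Prod>\<alpha>\<in>S. N \<alpha> p" and G = "\<lambda>p. \<Prod>q\<in>P. E q p"]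
        exp_poly_prod N E)
  then obtain r where r: "F r \<noteq> 0" ..
  \<comment> \<open>The point \<open>r\<close> is a function on all naturals, whereas a vector has
    unspecified entries beyond its dimension; \<open>F\<close> sees only the first
    \<open>\<zeta> + T\<close> coordinates.\<close>
  have F_cong: "F x = F y" if "\<And>i. i < \<zeta> + T \<Longrightarrow> x i = y i" for x y
  proof -
    have "G x = G y" if "exp_poly (\<zeta> + T) G" for G
      using that by (induction rule: exp_poly.induct) (simp_all add: \<open>\<And>i. i < \<zeta> + T \<Longrightarrow> x i = y i\<close>)
    then show ?thesis using F .
  qed
  have "F (vec_index (Matrix.vec (\<zeta> + T) r)) = F r"
    by (rule F_cong) simp
  then have nonzero: "\<exists>p\<in>carrier_vec (\<zeta> + T). F (vec_index p) \<noteq> 0"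
    using r by (intro bexI[of _ "Matrix.vec (\<zeta> + T) r"]) auto
  have "F (vec_index (z @\<^sub>v u)) = 0"
    if z: "z \<in> carrier_vec \<zeta>" and u: "u \<in> carrier_vec T"
      and bad: "\<not> (inj_on (attention z u) (token_seqs \<zeta> T) \<and>
        attention z u ` token_seqs \<zeta> T \<subseteq> UNIV - {0})" for z u
  proof -
    let ?p = "vec_index (z @\<^sub>v u)"
    have att: "attention z u \<alpha> = N \<alpha> ?p / D \<alpha> ?p" and pos: "D \<alpha> ?p \<noteq> 0" if "\<alpha> \<in> S" for \<alpha>
      using that attention_eq[OF _ z u] attn_denom_pos[of \<alpha> \<zeta> T ?p]
      by (auto simp: S_def N_def D_def)
    from bad consider \<alpha> \<beta> where "\<alpha> \<in> S" "\<beta> \<in> S" "\<alpha> \<noteq> \<beta>" "attention z u \<alpha> = attention z u \<beta>"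
      | \<alpha> where "\<alpha> \<in> S" "attention z u \<alpha> = 0"
      unfolding S_def inj_on_def image_subset_iff Diff_iff singleton_iff by blast
    then show ?thesis
    proof cases
      case 1
      \<comment> \<open>Equal quotients with nonzero denominators have equal cross products, which
        kills the factor of this pair.\<close>
      then have "(\<alpha>, \<beta>) \<in> P" "E (\<alpha>, \<beta>) ?p = 0"
        using att pos by (auto simp: P_def E_def frac_eq_eq)
      then show ?thesis using fin by (auto simp: F_def)
    next
      case 2
      then have "N \<alpha> ?p = 0" using att pos by simp
      then show ?thesis using 2(1) fin by (auto simp: F_def)
    qed
  qed
  then show ?thesis
    unfolding generic_pair_def using real_analytic_exp_poly[OF F] nonzero by blast
qed

end
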